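(* Let $c,\bar c\colon [a,b]\to\mathbb{R}^2$ be convex curves parameterized by affine arc length, with affine curvatures $\kappa$ and $\bar\kappa$ respectively, and let $$A=\frac12\int_a^b (c(s)-c(a))\wedge c'(s)\,ds,\qquad \bar A=\frac12\int_a^b (\bar c(s)-\bar c(a))\wedge \bar c'(s)\,ds$$ be the areas bounded by the respective curves and the segments between their endpoints. Assume that $\bar\kappa$ satisfies any one of the following three conditions: (a) $\bar\kappa$ is constant; (b) $\bar\kappa\le 0$; or (c) $\bar\kappa\le k_1$ where $k_1$ is a positive constant with $k_1\le (\pi/(b-a))^2$. Then $$\kappa\le\bar\kappa\ \text{ on } [a,b]\quad\text{implies}\quad A\ge \bar A,$$ $$\kappa\ge\bar\kappa\ \text{ on } [a,b]\quad\text{implies}\quad A\le \bar A.$$ In either case, $A=\bar A$ implies that $c$ is the image of $\bar c$ under a special affine motion.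
   Context: For $v=(v_1,v_2),w=(w_1,w_2)\in\mathbb{R}^2$ put $v\wedge w=v_1w_2-v_2w_1$. A $C^3$ curve $c\colon[a,b]\to\mathbb{R}^2$ is parameterized by affine arc length (has affine unit speed) if $c'(s)\wedge c''(s)=1$ for all $s$. Its affine curvature is the continuous function $\kappa$ with $c'''(s)=-\kappa(s)c'(s)$. A convex curve is an embedded connected curve (parameterized once by $c$, with $c(a)=c(b)$ allowed if it is closed) contained in the boundary of its convex hull. A special affine motion of $\mathbb{R}^2$ is a map $v\mapsto Mv+p$ with $M$ linear, $\det M=1$, and $p\in\mathbb{R}^2$. *)

theory Defs
  imports "HOL-Analysis.Analysis"
begin

definition wedge :: "real^2 \<Rightarrow> real^2 \<Rightarrow> real" where
  "wedge v w = v $ 1 * w $ 2 - v $ 2 * w $ 1"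

(* Derivative of a curve on [a,b], one-sided at the endpoints. It is meaningful only for a < b. *)
definition curve_deriv :: "real \<Rightarrow> real \<Rightarrow> (real \<Rightarrow> real^2) \<Rightarrow> real \<Rightarrow> real^2" where
  "curve_deriv a b c s = vector_derivative c (at s within {a..b})"

definition C3_curve :: "real \<Rightarrow> real \<Rightarrow> (real \<Rightarrow> real^2) \<Rightarrow> bool" where
  "C3_curve a b c \<longleftrightarrow>
     (\<forall>k<3. ((curve_deriv a b ^^ k) c) differentiable_on {a..b}) \<and>
     continuous_on {a..b} ((curve_deriv a b ^^ 3) c)"

definition affine_arclength_param :: "real \<Rightarrow> real \<Rightarrow> (real \<Rightarrow> real^2) \<Rightarrow> bool" where
  "affine_arclength_param a b c \<longleftrightarrow>
     C3_curve a b c \<and>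
     (\<forall>s\<in>{a..b}. wedge (curve_deriv a b c s) ((curve_deriv a b ^^ 2) c s) = 1)"

definition has_affine_curvature ::
    "real \<Rightarrow> real \<Rightarrow> (real \<Rightarrow> real^2) \<Rightarrow> (real \<Rightarrow> real) \<Rightarrow> bool" where
  "has_affine_curvature a b c \<kappa> \<longleftrightarrow>
     continuous_on {a..b} \<kappa> \<and>
     (\<forall>s\<in>{a..b}. (curve_deriv a b ^^ 3) c s = - \<kappa> s *\<^sub>R curve_deriv a b c s)"

(* A continuous map on the compact interval that is injective, except that c a = c b is permitted,
   is automatically an embedding of the interval or of the circle obtained by joining its ends.
   No tangency of c at the closing point is required. *)
definition convex_curve :: "real \<Rightarrow> real \<Rightarrow> (real \<Rightarrow> real^2) \<Rightarrow> bool" where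
  "convex_curve a b c \<longleftrightarrow>
     continuous_on {a..b} c \<and>
     (\<forall>s\<in>{a..b}. \<forall>t\<in>{a..b}. c s = c t \<longrightarrow> s = t \<or> {s, t} = {a, b}) \<and>
     c ` {a..b} \<subseteq> frontier (convex hull (c ` {a..b}))"

definition curve_area :: "real \<Rightarrow> real \<Rightarrow> (real \<Rightarrow> real^2) \<Rightarrow> real" where
  "curve_area a b c = 1/2 * integral {a..b} (\<lambda>s. wedge (c s - c a) (curve_deriv a b c s))"

definition special_affine_motion :: "(real^2 \<Rightarrow> real^2) \<Rightarrow> bool" where
  "special_affine_motion \<phi> \<longleftrightarrow>
     (\<exists>(M::real^2^2) p. det M = 1 \<and> \<phi> = (\<lambda>v. M *v v + p))"

end

theory Submission
  imports Defs
begin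

text \<open>
  The comparison rests on one identity. For a curve \<open>c\<close> of affine unit speed with affine curvature
  \<open>\<kappa>\<close>, seen from its starting point, and a second such curve \<open>d\<close> with curvature \<open>\<mu>\<close>, seen from its
  end point, put \<open>p = (c - c(a)) \<and> c'\<close> and \<open>q = d' \<and> (d(b) - d)\<close>. Because \<open>c' \<and> c'' = 1\<close> and
  \<open>c''' = -\<kappa> c'\<close>, these functions solve the inhomogeneous linear equations \<open>p'' = 1 - \<kappa> p\<close> and
  \<open>q'' = 1 - \<mu> q\<close>, hence
  \<open>(p' q - p q')' = q - p + (\<mu> - \<kappa>) p q\<close>.
  The bracket vanishes at both ends, since \<open>p\<close> and \<open>p'\<close> vanish at \<open>a\<close>, and \<open>q\<close> and \<open>q'\<close> at \<open>b\<close>.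
  As \<open>p\<close> integrates to twice the area of \<open>c\<close> and \<open>q\<close> to twice the area of \<open>d\<close>, integration gives
  \<open>2 (area c - area d) = \<integral> (\<mu> - \<kappa>) p q\<close> (lemma \<open>area_difference\<close>).

  A convex curve lies on the left of each of its tangent lines (lemma \<open>convex_left_of_tangent\<close>), so
  \<open>p\<close> and \<open>q\<close> are nonnegative and the sign of \<open>\<mu> - \<kappa>\<close> decides which area is larger. If the areas
  agree, then \<open>(\<mu> - \<kappa>) p q\<close> vanishes identically. The differential equations prevent \<open>p\<close> and \<open>q\<close>
  from vanishing on an interval, so \<open>\<kappa> = \<mu>\<close>. Two frames \<open>(c', c'')\<close> and \<open>(d', d'')\<close> that solve the
  same linear system differ by a constant matrix, which has determinant one because both frames do;
  this matrix is the linear part of the required motion.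
\<close>

section \<open>The wedge product\<close>

lemma bounded_bilinear_wedge: "bounded_bilinear wedge"
proof -
  have "bilinear wedge"
    unfolding bilinear_def
    by (auto intro!: linearI simp: wedge_def algebra_simps)
  then show ?thesis
    by (simp add: bilinear_conv_bounded_bilinear)
qed

lemmas wedge_has_derivative = bounded_bilinear.has_vector_derivative[OF bounded_bilinear_wedge]
lemmas wedge_continuous_on = bounded_bilinear.continuous_on[OF bounded_bilinear_wedge]

lemma wedge_self [simp]: "wedge v v = 0"
  and wedge_zero [simp]: "wedge 0 v = 0" "wedge v 0 = 0"
  and wedge_minus [simp]: "wedge v (- w) = - wedge v w" "wedge (- v) w = - wedge v w"
  and wedge_scaleR [simp]: "wedge v (r *\<^sub>R w) = r * wedge v w" "wedge (r *\<^sub>R v) w = r * wedge v w"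
  by (simp_all add: wedge_def algebra_simps)

lemma wedge_commute: "wedge w v = - wedge v w"
  by (simp add: wedge_def)

text \<open>
  A vector orthogonal to \<open>v\<close> is a multiple of \<open>v\<close> turned by a right angle, and the inner product
  with the latter is \<open>x \<mapsto> v \<and> x\<close>; evaluation at \<open>w\<close> reads off the factor.
\<close>
lemma inner_eq_wedge_if_orthogonal:
  fixes n v w x :: "real^2"
  assumes "n \<bullet> v = 0" and "wedge v w = 1"
  shows "n \<bullet> x = (n \<bullet> w) * wedge v x"
proof -
  have 1: "n$1 * v$1 + n$2 * v$2 = 0"
    using assms(1) by (simp add: inner_vec_def sum_2)
  have 2: "v$1 * w$2 - v$2 * w$1 = 1"
    using assms(2) by (simp add: wedge_def)
  have "n$1 * x$1 + n$2 * x$2 = (n$1 * w$1 + n$2 * w$2) * (v$1 * x$2 - v$2 * x$1)"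
    using 1 2 by algebra
  then show ?thesis
    by (simp add: inner_vec_def sum_2 wedge_def)
qed

section \<open>Curves of affine unit speed\<close>

text \<open>
  Naming the first two derivatives \<open>c1\<close> and \<open>c2\<close> turns affine arc length and affine curvature into a
  linear system for the moving frame. The degenerate case \<open>a = b\<close> would leave one-sided derivatives
  undetermined.
\<close>
locale affine_frame =
  fixes a b :: real and c c1 c2 :: "real \<Rightarrow> real^2" and \<kappa> :: "real \<Rightarrow> real"
  assumes less: "a < b"
    and deriv: "\<And>s. s \<in> {a..b} \<Longrightarrow> (c has_vector_derivative c1 s) (at s within {a..b})"
    and deriv1: "\<And>s. s \<in> {a..b} \<Longrightarrow> (c1 has_vector_derivative c2 s) (at s within {a..b})"
    and deriv2: "\<And>s. s \<in> {a..b} \<Longrightarrow>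
      (c2 has_vector_derivative - \<kappa> s *\<^sub>R c1 s) (at s within {a..b})"
    and unit: "\<And>s. s \<in> {a..b} \<Longrightarrow> wedge (c1 s) (c2 s) = 1"
    and cont_curv: "continuous_on {a..b} \<kappa>"
begin

lemma cont: "continuous_on {a..b} c"
  and cont1: "continuous_on {a..b} c1"
  by (rule continuous_on_vector_derivative, erule deriv)
    (rule continuous_on_vector_derivative, erule deriv1)

abbreviation "from_start s \<equiv> wedge (c s - c a) (c1 s)"
abbreviation "from_start' s \<equiv> wedge (c s - c a) (c2 s)"
abbreviation "to_end s \<equiv> wedge (c1 s) (c b - c s)"
abbreviation "to_end' s \<equiv> wedge (c2 s) (c b - c s)"

lemma cont_from_start: "continuous_on {a..b} from_start"
  and cont_to_end: "continuous_on {a..b} to_end"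
  by (intro wedge_continuous_on continuous_intros cont cont1)+

lemma from_start_deriv:
  assumes "s \<in> {a..b}"
  shows "(from_start has_vector_derivative from_start' s) (at s within {a..b})"
    and "(from_start' has_vector_derivative 1 - \<kappa> s * from_start s) (at s within {a..b})"
proof -
  have D: "((\<lambda>s. c s - c a) has_vector_derivative c1 s) (at s within {a..b})"
    using deriv[OF assms] by (auto intro!: derivative_eq_intros)
  show "(from_start has_vector_derivative from_start' s) (at s within {a..b})"
    using wedge_has_derivative[OF D deriv1[OF assms]] by simp
  show "(from_start' has_vector_derivative 1 - \<kappa> s * from_start s) (at s within {a..b})"
    using wedge_has_derivative[OF D deriv2[OF assms]] unit[OF assms] by (simp add: algebra_simps)
qed

lemma to_end_deriv:
  assumes "s \<in> {a..b}"
  shows "(to_end has_vector_derivative to_end' s) (at s within {a..b})"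
    and "(to_end' has_vector_derivative 1 - \<kappa> s * to_end s) (at s within {a..b})"
proof -
  have D: "((\<lambda>s. c b - c s) has_vector_derivative - c1 s) (at s within {a..b})"
    using deriv[OF assms] by (auto intro!: derivative_eq_intros)
  show "(to_end has_vector_derivative to_end' s) (at s within {a..b})"
    using wedge_has_derivative[OF deriv1[OF assms] D] by simp
  show "(to_end' has_vector_derivative 1 - \<kappa> s * to_end s) (at s within {a..b})"
    using wedge_has_derivative[OF deriv2[OF assms] D] unit[OF assms] wedge_commute[of "c2 s" "c1 s"]
    by (simp add: algebra_simps)
qed

end

lemma affine_frame_of_param:
  assumes "a < b" and "affine_arclength_param a b c" and "has_affine_curvature a b c \<kappa>"
  shows "affine_frame a b c (curve_deriv a b c) ((curve_deriv a b ^^ 2) c) \<kappa>"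
proof
  have diff: "((curve_deriv a b ^^ k) c) differentiable_on {a..b}" if "k < 3" for k
    using assms(2) that by (auto simp: affine_arclength_param_def C3_curve_def)
  have D: "((curve_deriv a b ^^ k) c has_vector_derivative (curve_deriv a b ^^ Suc k) c s)
      (at s within {a..b})" if "k < 3" "s \<in> {a..b}" for k s
    using diff[OF that(1)] that(2)
    by (auto simp: differentiable_on_def vector_derivative_works curve_deriv_def)
  fix s assume s: "s \<in> {a..b}"
  show "(c has_vector_derivative curve_deriv a b c s) (at s within {a..b})"
    using D[of 0, OF _ s] by simp
  show "(curve_deriv a b c has_vector_derivative (curve_deriv a b ^^ 2) c s) (at s within {a..b})"
    using D[of 1, OF _ s] by (simp add: numeral_2_eq_2)
  show "((curve_deriv a b ^^ 2) c has_vector_derivative - \<kappa> s *\<^sub>R curve_deriv a b c s)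
      (at s within {a..b})"
    using D[of 2, OF _ s] assms(3) s
    by (simp add: has_affine_curvature_def numeral_3_eq_3 numeral_2_eq_2)
  show "wedge (curve_deriv a b c s) ((curve_deriv a b ^^ 2) c s) = 1"
    using assms(2) s by (simp add: affine_arclength_param_def)
next
  show "a < b" by fact
  show "continuous_on {a..b} \<kappa>"
    using assms(3) by (simp add: has_affine_curvature_def)
qed

text \<open>
  If \<open>f\<close> vanishes on an open set, then so does \<open>f''\<close>, whereas the equation \<open>f'' = 1 - \<kappa> f\<close> makes
  \<open>f''\<close> equal to one there.
\<close>
lemma nonzero_somewhere_if_forced:
  fixes f f' \<kappa> :: "real \<Rightarrow> real"
  assumes f: "\<And>s. s \<in> {a..b} \<Longrightarrow> (f has_vector_derivative f' s) (at s within {a..b})"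
    and f': "\<And>s. s \<in> {a..b} \<Longrightarrow> (f' has_vector_derivative 1 - \<kappa> s * f s) (at s within {a..b})"
    and S: "open S" "S \<subseteq> {a<..<b}" "S \<noteq> {}"
  shows "\<exists>s\<in>S. f s \<noteq> 0"
proof (rule ccontr)
  assume "\<not> ?thesis"
  then have zero: "f s = 0" if "s \<in> S" for s using that by blast
  have at_S: "at s within {a..b} = at s" if "s \<in> S" for s
    using that S(2) by (intro at_within_interior) auto
  have Sab: "s \<in> {a..b}" if "s \<in> S" for s using that S(2) by auto
  have zero': "f' s = 0" if "s \<in> S" for s
  proof -
    have "(f has_vector_derivative 0) (at s)"
      by (rule has_vector_derivative_transform_within_open[OF _ S(1) that, of "\<lambda>_. 0"])
        (auto simp: zero)
    then show ?thesis
      using f[OF Sab[OF that]] vector_derivative_unique_at at_S[OF that] by metis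
  qed
  obtain s where s: "s \<in> S" using S(3) by blast
  have "(f' has_vector_derivative 0) (at s)"
    by (rule has_vector_derivative_transform_within_open[OF _ S(1) s, of "\<lambda>_. 0"])
      (auto simp: zero')
  moreover have "(f' has_vector_derivative 1) (at s)"
    using f'[OF Sab[OF s]] at_S[OF s] zero[OF s] by simp
  ultimately show False
    using vector_derivative_unique_at by fastforce
qed

section \<open>The area identity\<close>

lemma area_difference:
  assumes "affine_frame a b c c1 c2 \<kappa>" and "affine_frame a b d d1 d2 \<mu>"
  shows "((\<lambda>s. (\<mu> s - \<kappa> s) * (wedge (c s - c a) (c1 s) * wedge (d1 s) (d b - d s))) has_integral
    integral {a..b} (\<lambda>s. wedge (c s - c a) (c1 s)) - integral {a..b} (\<lambda>s. wedge (d s - d a) (d1 s)))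
    {a..b}"
proof -
  interpret c: affine_frame a b c c1 c2 \<kappa> by fact
  interpret d: affine_frame a b d d1 d2 \<mu> by fact
  \<comment> \<open>The second summand of \<open>B\<close> replaces the integral of \<open>d.to_end\<close> by that of \<open>d.from_start\<close>.\<close>
  define B where "B s = (c.from_start' s * d.to_end s - c.from_start s * d.to_end' s)
    - wedge (d s - d a) (d b - d s)" for s
  have "(B has_vector_derivative (\<mu> s - \<kappa> s) * (c.from_start s * d.to_end s)
      - (c.from_start s - d.from_start s)) (at s within {a..b})" if s: "s \<in> {a..b}" for s
  proof -
    have D: "((\<lambda>s. d s - d a) has_vector_derivative d1 s) (at s within {a..b})"
      "((\<lambda>s. d b - d s) has_vector_derivative - d1 s) (at s within {a..b})"
      using d.deriv[OF s] by (auto intro!: derivative_eq_intros)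
    have W: "((\<lambda>s. wedge (d s - d a) (d b - d s)) has_vector_derivative
        d.to_end s - d.from_start s) (at s within {a..b})"
      using wedge_has_derivative[OF D] by simp
    note mult = bounded_bilinear.has_vector_derivative[OF bounded_bilinear_mult]
    show ?thesis
      unfolding B_def
      by (rule has_vector_derivative_eq_rhs, rule has_vector_derivative_diff,
          rule has_vector_derivative_diff, rule mult, rule c.from_start_deriv[OF s],
          rule d.to_end_deriv[OF s], rule mult, rule c.from_start_deriv[OF s],
          rule d.to_end_deriv[OF s], rule W) (simp add: algebra_simps)
  qed
  then have I: "((\<lambda>s. (\<mu> s - \<kappa> s) * (c.from_start s * d.to_end s)
      - (c.from_start s - d.from_start s)) has_integral B b - B a) {a..b}"
    using c.less by (intro fundamental_theorem_of_calculus) auto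
  have B: "B b - B a = 0"
    by (simp add: B_def)
  have D: "((\<lambda>s. c.from_start s - d.from_start s) has_integral
      integral {a..b} c.from_start - integral {a..b} d.from_start) {a..b}"
    by (intro has_integral_diff integrable_integral integrable_continuous_real
        c.cont_from_start d.cont_from_start)
  show ?thesis
    using has_integral_add[OF I D] by (simp add: B)
qed

section \<open>Convexity\<close>

text \<open>
  If \<open>S\<close> has empty interior, then a hyperplane that contains \<open>S\<close> supports it everywhere. Otherwise
  the interior agrees with the relative interior, for which supporting hyperplanes exist.
\<close>
lemma supporting_hyperplane_frontier:
  fixes S :: "'a::euclidean_space set"
  assumes "convex S" and "x \<in> S" and "x \<in> frontier S"
  obtains n where "n \<noteq> 0" and "\<And>y. y \<in> S \<Longrightarrow> n \<bullet> x \<le> n \<bullet> y"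
proof (cases "interior S = {}")
  case True
  then obtain n k where "n \<noteq> 0" and k: "S \<subseteq> {x. n \<bullet> x = k}"
    using empty_interior_subset_hyperplane[OF assms(1)] by blast
  have "n \<bullet> y = k" if "y \<in> S" for y
    using k that by blast
  with \<open>n \<noteq> 0\<close> show ?thesis
    using assms(2) by (intro that[of n]) auto
next
  case False
  then have "x \<notin> rel_interior S"
    using assms(3) by (simp add: rel_interior_nonempty_interior frontier_def)
  then show ?thesis
    using supporting_hyperplane_rel_boundary[OF assms(1,2)] that by metis
qed

text \<open>
  A supporting line at an interior point of the curve must be the tangent line. Hence some multiple
  \<open>m\<close> of \<open>x \<mapsto> c'(r) \<and> (x - c(r))\<close> is nonnegative on the curve, and along the curve it has second
  derivative \<open>m\<close> at its minimum \<open>r\<close>, so \<open>m\<close> is positive.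
\<close>
lemma convex_left_of_tangent:
  assumes "affine_frame a b c c1 c2 \<kappa>" and convex: "convex_curve a b c"
    and r: "r \<in> {a<..<b}" and s: "s \<in> {a..b}"
  shows "wedge (c1 r) (c s - c r) \<ge> 0"
proof -
  interpret affine_frame a b c c1 c2 \<kappa> by fact
  have rab: "r \<in> {a..b}" using r by auto
  let ?H = "convex hull (c ` {a..b})"
  have "c r \<in> frontier ?H"
    using convex rab by (auto simp: convex_curve_def)
  moreover have "c r \<in> ?H"
    using rab by (intro hull_inc) auto
  ultimately obtain n where n: "n \<noteq> 0" and supp: "\<And>y. y \<in> ?H \<Longrightarrow> n \<bullet> c r \<le> n \<bullet> y"
    using supporting_hyperplane_frontier[of ?H "c r"] by (metis convex_convex_hull)
  have min: "n \<bullet> c r \<le> n \<bullet> c t" if "t \<in> {a..b}" for t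
    using that by (intro supp hull_inc) auto
  have at: "at t within {a..b} = at t" if "t \<in> {a<..<b}" for t
    using that by (intro at_within_interior) auto
  have D: "((\<lambda>s. n \<bullet> c s) has_real_derivative n \<bullet> c1 t) (at t)" if "t \<in> {a<..<b}" for t
    using deriv[of t] that at[OF that]
    by (auto simp: has_real_derivative_iff_has_vector_derivative
        intro!: bounded_linear.has_vector_derivative[OF bounded_linear_inner_right])
  have D1: "((\<lambda>s. n \<bullet> c1 s) has_real_derivative n \<bullet> c2 r) (at r)"
    using deriv1[OF rab] at[OF r]
    by (auto simp: has_real_derivative_iff_has_vector_derivative
        intro!: bounded_linear.has_vector_derivative[OF bounded_linear_inner_right])
  have orth: "n \<bullet> c1 r = 0"
  proof (rule DERIV_local_min[OF D[OF r]])
    show "0 < min (r - a) (b - r)" using r by auto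
    show "\<forall>y. \<bar>r - y\<bar> < min (r - a) (b - r) \<longrightarrow> n \<bullet> c r \<le> n \<bullet> c y"
      by (intro allI impI min) auto
  qed
  have inner: "n \<bullet> x = (n \<bullet> c2 r) * wedge (c1 r) x" for x
    by (rule inner_eq_wedge_if_orthogonal[OF orth unit[OF rab]])
  have "n \<bullet> c2 r \<noteq> 0"
    using inner[of n] n by auto
  moreover have "\<not> n \<bullet> c2 r < 0"
  proof
    assume "n \<bullet> c2 r < 0"
    from DERIV_neg_dec_right[OF D1 this] obtain e where e: "e > 0"
      "\<And>h. 0 < h \<Longrightarrow> h < e \<Longrightarrow> n \<bullet> c1 (r + h) < n \<bullet> c1 r" by blast
    define h where "h = min (e/2) ((b - r)/2)"
    have h: "0 < h" "h < e" "r + h < b" using e(1) r by (auto simp: h_def min_def field_simps)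
    have "n \<bullet> c (r + h) < n \<bullet> c r"
    proof (rule DERIV_neg_imp_decreasing_open[of r "r + h" "\<lambda>s. n \<bullet> c s"])
      fix t assume "r < t" "t < r + h"
      then show "\<exists>y. ((\<lambda>s. n \<bullet> c s) has_real_derivative y) (at t) \<and> y < 0"
        using e(2)[of "t - r"] D[of t] h r orth by auto
    next
      show "continuous_on {r..r + h} (\<lambda>s. n \<bullet> c s)"
        using h r by (intro continuous_intros continuous_on_subset[OF cont]) auto
    qed (use h in auto)
    with min[of "r + h"] h r show False by auto
  qed
  ultimately have "n \<bullet> c2 r > 0" by simp
  moreover have "0 \<le> (n \<bullet> c2 r) * wedge (c1 r) (c s - c r)"
    using min[OF s] inner[of "c s - c r"] by (simp add: inner_diff_right)
  ultimately show ?thesis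
    by (simp add: zero_le_mult_iff)
qed

text \<open>
  The endpoints, where tangent lines need not support, are harmless: one factor vanishes there.
\<close>
lemma convex_product_nonneg:
  assumes c: "affine_frame a b c c1 c2 \<kappa>" "convex_curve a b c"
    and d: "affine_frame a b d d1 d2 \<mu>" "convex_curve a b d"
    and s: "s \<in> {a..b}"
  shows "0 \<le> wedge (c s - c a) (c1 s) * wedge (d1 s) (d b - d s)"
proof (cases "s \<in> {a<..<b}")
  case True
  have "wedge (c s - c a) (c1 s) = wedge (c1 s) (c a - c s)"
    by (simp add: wedge_def algebra_simps)
  with True s show ?thesis
    using convex_left_of_tangent[OF c True, of a] convex_left_of_tangent[OF d True, of b] by auto
next
  case False
  with s have "s = a \<or> s = b" by auto
  then show ?thesis by auto
qed

section \<open>Rigidity\<close>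

lemma curvatures_agree_if_product_vanishes:
  assumes "affine_frame a b c c1 c2 \<kappa>" and "affine_frame a b d d1 d2 \<mu>"
    and vanish: "\<And>s. s \<in> {a..b} \<Longrightarrow>
      (\<mu> s - \<kappa> s) * (wedge (c s - c a) (c1 s) * wedge (d1 s) (d b - d s)) = 0"
    and s: "s \<in> {a..b}"
  shows "\<mu> s = \<kappa> s"
proof -
  interpret c: affine_frame a b c c1 c2 \<kappa> by fact
  interpret d: affine_frame a b d d1 d2 \<mu> by fact
  have open_nonzero: "open {t \<in> {a<..<b}. f t \<noteq> 0}" if "continuous_on {a..b} f" for f :: "real \<Rightarrow> real"
  proof -
    have "continuous_on {a<..<b} f" by (rule continuous_on_subset[OF that]) auto
    then have "open ({a<..<b} \<inter> f -` (- {0}))"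
      by (intro continuous_open_preimage) auto
    moreover have "{a<..<b} \<inter> f -` (- {0}) = {t \<in> {a<..<b}. f t \<noteq> 0}" by auto
    ultimately show ?thesis by simp
  qed
  have diff: "continuous_on {a..b} (\<lambda>t. \<mu> t - \<kappa> t)"
    by (intro continuous_intros c.cont_curv d.cont_curv)
  have inside: "\<mu> t - \<kappa> t = 0" if "t \<in> {a<..<b}" for t
  proof (rule ccontr)
    assume nz: "\<mu> t - \<kappa> t \<noteq> 0"
    define U where "U = {t \<in> {a<..<b}. \<mu> t - \<kappa> t \<noteq> 0}"
    define V where "V = {t \<in> {a<..<b}. c.from_start t \<noteq> 0}"
    have U: "open U" "U \<subseteq> {a<..<b}" "U \<noteq> {}"
      using open_nonzero[OF diff] that nz by (auto simp: U_def)
    have "\<exists>s\<in>U. c.from_start s \<noteq> 0"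
      by (rule nonzero_somewhere_if_forced[OF c.from_start_deriv U])
    then have "U \<inter> V \<noteq> {}" by (auto simp: U_def V_def)
    moreover have "open (U \<inter> V)"
      using U(1) open_nonzero[OF c.cont_from_start] by (simp add: V_def open_Int)
    ultimately have "\<exists>s\<in>U \<inter> V. d.to_end s \<noteq> 0"
      using U(2) by (intro nonzero_somewhere_if_forced[OF d.to_end_deriv]) auto
    then obtain s where "s \<in> U" "s \<in> V" "d.to_end s \<noteq> 0" by blast
    then show False
      using vanish[of s] by (simp add: U_def V_def)
  qed
  have "closure {a<..<b} = {a..b}" using c.less by simp
  then have "\<mu> s - \<kappa> s = 0"
    using continuous_constant_on_closure[of "{a<..<b}" "\<lambda>t. \<mu> t - \<kappa> t" 0 s] diff inside s by auto
  then show ?thesis by simp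
qed

text \<open>
  The linear map that carries the frame of \<open>d\<close> at \<open>s\<close> to that of \<open>c\<close> at \<open>s\<close> does not depend on \<open>s\<close>:
  it is the quotient of two fundamental solutions of the same linear system. Its value on \<open>v\<close> is
  written with Cramer's rule, as the coordinates of \<open>v\<close> in the frame of \<open>d\<close> are \<open>v \<and> d''\<close> and
  \<open>d' \<and> v\<close>.
\<close>
lemma same_curvature_imp_special_affine:
  assumes "affine_frame a b c c1 c2 \<kappa>" and "affine_frame a b d d1 d2 \<mu>"
    and eq: "\<And>s. s \<in> {a..b} \<Longrightarrow> \<mu> s = \<kappa> s"
  shows "\<exists>\<phi>. special_affine_motion \<phi> \<and> (\<forall>s\<in>{a..b}. c s = \<phi> (d s))"
proof -
  interpret c: affine_frame a b c c1 c2 \<kappa> by fact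
  interpret d: affine_frame a b d d1 d2 \<mu> by fact
  have aab: "a \<in> {a..b}" using c.less by simp
  define F where "F s v = wedge v (d2 s) *\<^sub>R c1 s + wedge (d1 s) v *\<^sub>R c2 s" for s v
  have F_const: "F s v = F a v" if s: "s \<in> {a..b}" for s v
  proof -
    have "((\<lambda>s. F s v) has_vector_derivative 0) (at t within {a..b})" if t: "t \<in> {a..b}" for t
    proof -
      have 1: "((\<lambda>s. wedge v (d2 s)) has_vector_derivative - \<kappa> t * wedge v (d1 t))
          (at t within {a..b})"
        using wedge_has_derivative[OF has_vector_derivative_const d.deriv2[OF t], of v] eq[OF t]
        by simp
      have 2: "((\<lambda>s. wedge (d1 s) v) has_vector_derivative wedge (d2 t) v) (at t within {a..b})"
        using wedge_has_derivative[OF d.deriv1[OF t] has_vector_derivative_const, of v] by simp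
      note scale = bounded_bilinear.has_vector_derivative[OF bounded_bilinear_scaleR]
      have "((\<lambda>s. F s v) has_vector_derivative
          (wedge v (d2 t) *\<^sub>R c2 t + (- \<kappa> t * wedge v (d1 t)) *\<^sub>R c1 t)
          + (wedge (d1 t) v *\<^sub>R (- \<kappa> t *\<^sub>R c1 t) + wedge (d2 t) v *\<^sub>R c2 t)) (at t within {a..b})"
        unfolding F_def
        by (intro has_vector_derivative_add scale[OF 1 c.deriv1[OF t]] scale[OF 2 c.deriv2[OF t]])
      then show ?thesis
        by (simp add: wedge_commute[of v] algebra_simps)
    qed
    then obtain k where "\<forall>t\<in>{a..b}. F t v = k"
      using has_vector_derivative_zero_constant[of "{a..b}" "\<lambda>s. F s v"]
      by (metis convex_real_interval(5))
    with s aab show ?thesis by simp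
  qed
  define M :: "real^2^2" where "M = matrix (F a)"
  have "linear (F a)"
    by (intro linearI) (simp_all add: F_def wedge_def algebra_simps vec_eq_iff)
  then have M: "M *v v = F a v" for v
    by (simp add: M_def matrix_works)
  have "det M = wedge (c1 a) (c2 a) * wedge (d1 a) (d2 a)"
    by (simp add: M_def matrix_def det_2 F_def wedge_def axis_def algebra_simps)
  then have "det M = 1"
    using c.unit[OF aab] d.unit[OF aab] by simp
  moreover have M_tangent: "M *v d1 s = c1 s" if "s \<in> {a..b}" for s
  proof -
    have "M *v d1 s = F s (d1 s)" using M F_const[OF that] by simp
    also have "\<dots> = c1 s" using d.unit[OF that] by (simp add: F_def)
    finally show ?thesis .
  qed
  have "((\<lambda>s. c s - M *v d s) has_vector_derivative 0) (at s within {a..b})" if "s \<in> {a..b}" for s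
    using has_vector_derivative_diff[OF c.deriv[OF that]
        bounded_linear.has_vector_derivative[OF matrix_vector_mul_bounded_linear[of M] d.deriv[OF that]]]
      M_tangent[OF that]
    by simp
  then obtain p where p: "\<forall>s\<in>{a..b}. c s - M *v d s = p"
    using has_vector_derivative_zero_constant[of "{a..b}" "\<lambda>s. c s - M *v d s"]
    by (metis convex_real_interval(5))
  ultimately show ?thesis
    by (intro exI[of _ "\<lambda>v. M *v v + p"]) (auto simp: special_affine_motion_def algebra_simps)
qed

section \<open>The comparison theorem\<close>

theorem theorem1:
  fixes a b :: real
    and c cbar :: "real \<Rightarrow> real^2"
    and \<kappa> \<kappa>bar :: "real \<Rightarrow> real"
  assumes "a < b"
    and "convex_curve a b c" and "convex_curve a b cbar"
    and "affine_arclength_param a b c" and "affine_arclength_param a b cbar"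
    and "has_affine_curvature a b c \<kappa>" and "has_affine_curvature a b cbar \<kappa>bar"
    and "(\<exists>k. \<forall>s\<in>{a..b}. \<kappa>bar s = k)
         \<or> (\<forall>s\<in>{a..b}. \<kappa>bar s \<le> 0)
         \<or> (\<exists>k1>0. k1 \<le> (pi / (b - a))^2 \<and> (\<forall>s\<in>{a..b}. \<kappa>bar s \<le> k1))"
  shows "((\<forall>s\<in>{a..b}. \<kappa> s \<le> \<kappa>bar s) \<longrightarrow> curve_area a b c \<ge> curve_area a b cbar)
       \<and> ((\<forall>s\<in>{a..b}. \<kappa> s \<ge> \<kappa>bar s) \<longrightarrow> curve_area a b c \<le> curve_area a b cbar)
       \<and> (((\<forall>s\<in>{a..b}. \<kappa> s \<le> \<kappa>bar s) \<or> (\<forall>s\<in>{a..b}. \<kappa> s \<ge> \<kappa>bar s))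
            \<and> curve_area a b c = curve_area a b cbar
          \<longrightarrow> (\<exists>\<phi>. special_affine_motion \<phi> \<and> (\<forall>s\<in>{a..b}. c s = \<phi> (cbar s))))"
proof -
  note c = affine_frame_of_param[OF assms(1) assms(4) assms(6)]
  note d = affine_frame_of_param[OF assms(1) assms(5) assms(7)]
  interpret c: affine_frame a b c "curve_deriv a b c" "(curve_deriv a b ^^ 2) c" \<kappa> by (rule c)
  interpret d: affine_frame a b cbar "curve_deriv a b cbar" "(curve_deriv a b ^^ 2) cbar" \<kappa>bar
    by (rule d)
  define P where "P s = c.from_start s * d.to_end s" for s
  have P_nonneg: "0 \<le> P s" if "s \<in> {a..b}" for s
    unfolding P_def by (rule convex_product_nonneg[OF c assms(2) d assms(3) that])
  have int: "((\<lambda>s. (\<kappa>bar s - \<kappa> s) * P s) has_integral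
      2 * (curve_area a b c - curve_area a b cbar)) {a..b}"
    using area_difference[OF c d] by (simp add: P_def curve_area_def)
  have int': "((\<lambda>s. (\<kappa> s - \<kappa>bar s) * P s) has_integral
      2 * (curve_area a b cbar - curve_area a b c)) {a..b}"
    using has_integral_neg[OF int] by (simp add: algebra_simps)
  have contP: "continuous_on {a..b} P"
    unfolding P_def by (intro continuous_intros c.cont_from_start d.cont_to_end)
  have motion: "\<exists>\<phi>. special_affine_motion \<phi> \<and> (\<forall>s\<in>{a..b}. c s = \<phi> (cbar s))"
    if "\<And>s. s \<in> {a..b} \<Longrightarrow> (\<kappa>bar s - \<kappa> s) * P s = 0"
    using same_curvature_imp_special_affine[OF c d curvatures_agree_if_product_vanishes[OF c d]]
      that by (simp add: P_def)
  show ?thesis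
  proof (intro conjI impI)
    assume "\<forall>s\<in>{a..b}. \<kappa> s \<le> \<kappa>bar s"
    then show "curve_area a b c \<ge> curve_area a b cbar"
      using has_integral_nonneg[OF int] P_nonneg by simp
  next
    assume "\<forall>s\<in>{a..b}. \<kappa> s \<ge> \<kappa>bar s"
    then show "curve_area a b c \<le> curve_area a b cbar"
      using has_integral_nonneg[OF int'] P_nonneg by simp
  next
    assume H: "((\<forall>s\<in>{a..b}. \<kappa> s \<le> \<kappa>bar s) \<or> (\<forall>s\<in>{a..b}. \<kappa> s \<ge> \<kappa>bar s))
            \<and> curve_area a b c = curve_area a b cbar"
    have zero: "f s = 0" if "(f has_integral 0) {a..b}" "continuous_on {a..b} f"
      "\<And>s. s \<in> {a..b} \<Longrightarrow> 0 \<le> f s" "s \<in> {a..b}" for f :: "real \<Rightarrow> real" and s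
      using has_integral_0_cbox_imp_0[of a b f s] that assms(1) by auto
    from H show "\<exists>\<phi>. special_affine_motion \<phi> \<and> (\<forall>s\<in>{a..b}. c s = \<phi> (cbar s))"
    proof (elim conjE disjE)
      assume le: "\<forall>s\<in>{a..b}. \<kappa> s \<le> \<kappa>bar s" and A: "curve_area a b c = curve_area a b cbar"
      show ?thesis
      proof (rule motion)
        fix s assume "s \<in> {a..b}"
        then show "(\<kappa>bar s - \<kappa> s) * P s = 0"
          using int A le P_nonneg contP
          by (intro zero[of "\<lambda>s. (\<kappa>bar s - \<kappa> s) * P s"])
            (auto intro!: continuous_intros c.cont_curv d.cont_curv)
      qed
    next
      assume ge: "\<forall>s\<in>{a..b}. \<kappa> s \<ge> \<kappa>bar s" and A: "curve_area a b c = curve_area a b cbar"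
      show ?thesis
      proof (rule motion)
        fix s assume "s \<in> {a..b}"
        then have "(\<kappa> s - \<kappa>bar s) * P s = 0"
          using int' A ge P_nonneg contP
          by (intro zero[of "\<lambda>s. (\<kappa> s - \<kappa>bar s) * P s"])
            (auto intro!: continuous_intros c.cont_curv d.cont_curv)
        then show "(\<kappa>bar s - \<kappa> s) * P s = 0" by auto
      qed
    qed
  qed
qed

end
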